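(* Let $[a,b]\subset(0,\infty)$, let $\gamma(t)=(t,0,z(t))$, $t\in[a,b]$, be a smooth curve in the $xz$-plane of $\mathbb{I}^3$, and let $S_\gamma$ be the surface of revolution $$\mathbf r(t,\theta)=(t\cos\theta,t\sin\theta,z(t)),\qquad t\in[a,b],\ \theta\in[0,2\pi].$$ If $S_\gamma$ is a surface of minimum relative area, i.e. $\gamma$ minimizes the relative area $\mathcal{A}[\gamma]=\int_a^b\int_0^{2\pi}\mathrm{d}A^*$ of $S_\gamma$ among all smooth curves of the form $(t,0,z(t))$, $t\in[a,b]$, with the same prescribed values $z(a)$ and $z(b)$, then either $\gamma$ is a horizontal line (and $S_\gamma$ is contained in a horizontal plane), or $\gamma$ is an isotropic catenary with respect to $L_z$ with $\lambda=0$, that is, $z(t)=c\ln t+d$ for some $c,d\in\mathbb{R}$, $c\neq0$.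
   Context: The simply isotropic space $\mathbb{I}^3$ is $\mathbb{R}^3$ with coordinates $(x,y,z)$ and the degenerate metric $\langle\mathbf u,\mathbf v\rangle=u^1v^1+u^2v^2$. $L_z$ is the $z$-axis. For a parametrized surface $\mathbf r(u^1,u^2)=(x^1,x^2,x^3)$ write $\mathbf r_i=\partial\mathbf r/\partial u^i$, $x^j_i=\partial x^j/\partial u^i$, and $X_{ij}=x_1^ix_2^j-x_1^jx_2^i$; the surface is admissible if $X_{12}\neq0$, and one takes $X_{12}>0$. The parabolic normal is $\mathbf N_{par}=\left(\frac{X_{23}}{X_{12}},\frac{X_{31}}{X_{12}},\frac12-\frac{X_{23}^2+X_{31}^2}{2X_{12}^2}\right)$ and the relative area element is $\mathrm{d}A^*=\det(\mathbf r_1,\mathbf r_2,\mathbf N_{par})\,\mathrm{d}u^1\mathrm{d}u^2$. *)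

theory Defs
  imports "HOL-Analysis.Analysis"
begin

text \<open>
  \<open>C\<^sup>\<infinity>\<close> on \<open>S\<close>: there are derivatives of all orders on \<open>S\<close>, taken relative to \<open>S\<close>, hence
  one-sided at the endpoints when \<open>S\<close> is a compact interval.
\<close>

definition smooth_on :: "real set \<Rightarrow> (real \<Rightarrow> 'a::real_normed_vector) \<Rightarrow> bool" where
  "smooth_on S f \<longleftrightarrow>
     (\<exists>F. F 0 = f \<and>
          (\<forall>(n::nat). \<forall>t\<in>S. (F n has_vector_derivative F (Suc n) t) (at t within S)))"

text \<open>
  A surface patch is a map \<open>r :: real \<Rightarrow> real \<Rightarrow> real ^ 3\<close> considered on \<open>U \<times> V\<close>; its partial
  derivatives are taken relative to \<open>U\<close> and \<open>V\<close>.
\<close>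

definition partial1 :: "real set \<Rightarrow> (real \<Rightarrow> real \<Rightarrow> real ^ 3) \<Rightarrow> real \<Rightarrow> real \<Rightarrow> real ^ 3" where
  "partial1 U r u v = vector_derivative (\<lambda>s. r s v) (at u within U)"

definition partial2 :: "real set \<Rightarrow> (real \<Rightarrow> real \<Rightarrow> real ^ 3) \<Rightarrow> real \<Rightarrow> real \<Rightarrow> real ^ 3" where
  "partial2 V r u v = vector_derivative (\<lambda>s. r u s) (at v within V)"

text \<open>The minors \<open>X\<^sub>i\<^sub>j\<close> of a pair of tangent vectors \<open>p = r\<^sub>1\<close>, \<open>q = r\<^sub>2\<close>.\<close>

definition minor :: "real ^ 3 \<Rightarrow> real ^ 3 \<Rightarrow> 3 \<Rightarrow> 3 \<Rightarrow> real" where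
  "minor p q i j = p $ i * q $ j - p $ j * q $ i"

definition parabolic_normal :: "real ^ 3 \<Rightarrow> real ^ 3 \<Rightarrow> real ^ 3" where
  "parabolic_normal p q =
     vector [minor p q 2 3 / minor p q 1 2,
             minor p q 3 1 / minor p q 1 2,
             1 / 2 - ((minor p q 2 3)\<^sup>2 + (minor p q 3 1)\<^sup>2) / (2 * (minor p q 1 2)\<^sup>2)]"

definition relative_area_density ::
    "real set \<Rightarrow> real set \<Rightarrow> (real \<Rightarrow> real \<Rightarrow> real ^ 3) \<Rightarrow> real \<Rightarrow> real \<Rightarrow> real" where
  "relative_area_density U V r u v =
     (let p = partial1 U r u v; q = partial2 V r u v
      in det (vector [p, q, parabolic_normal p q] :: real ^ 3 ^ 3))"

definition relative_area ::
    "real set \<Rightarrow> real set \<Rightarrow> (real \<Rightarrow> real \<Rightarrow> real ^ 3) \<Rightarrow> real" where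
  "relative_area U V r =
     integral U (\<lambda>u. integral V (\<lambda>v. relative_area_density U V r u v))"

definition profile_curve :: "(real \<Rightarrow> real) \<Rightarrow> real \<Rightarrow> real ^ 3" where
  "profile_curve z t = vector [t, 0, z t]"

definition revolution :: "(real \<Rightarrow> real) \<Rightarrow> real \<Rightarrow> real \<Rightarrow> real ^ 3" where
  "revolution z t \<theta> = vector [t * cos \<theta>, t * sin \<theta>, z t]"

definition revolution_surface :: "real \<Rightarrow> real \<Rightarrow> (real \<Rightarrow> real) \<Rightarrow> (real ^ 3) set" where
  "revolution_surface a b z = {revolution z t \<theta> | t \<theta>. t \<in> {a..b} \<and> \<theta> \<in> {0..2 * pi}}"

definition revolution_relative_area :: "real \<Rightarrow> real \<Rightarrow> (real \<Rightarrow> real) \<Rightarrow> real" where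
  "revolution_relative_area a b z = relative_area {a..b} {0..2 * pi} (revolution z)"

definition minimum_relative_area :: "real \<Rightarrow> real \<Rightarrow> (real \<Rightarrow> real) \<Rightarrow> bool" where
  "minimum_relative_area a b z \<longleftrightarrow>
     smooth_on {a..b} (profile_curve z) \<and>
     (\<forall>w. smooth_on {a..b} (profile_curve w) \<and> w a = z a \<and> w b = z b \<longrightarrow>
          revolution_relative_area a b z \<le> revolution_relative_area a b w)"

definition horizontal_plane :: "real \<Rightarrow> (real ^ 3) set" where
  "horizontal_plane h = {p. p $ 3 = h}"

end

theory Submission
  imports Defs
begin

text \<open>
  The relative area of the surface of revolution with profile \<open>z\<close> is \<open>\<pi>\<close> times the integral of
  \<open>t (1 + z'\<^sup>2)\<close>. If \<open>w t = c ln t + d\<close> has the same boundary values as \<open>z\<close>, then \<open>t w'\<close> is the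
  constant \<open>c\<close>, so that
  \<open>t (1 + z'\<^sup>2) = t (1 + w'\<^sup>2) + t (z' - w')\<^sup>2 + 2 c (z - w)'\<close>, and the last term integrates to \<open>0\<close>.
  Minimality of \<open>z\<close> therefore forces \<open>z' = w'\<close>, hence \<open>z = w\<close>; the case \<open>c = 0\<close> is the horizontal line.
\<close>

text \<open>As a combination of constant axis vectors, a curve given by its coordinates can be
  differentiated by the rules for sums and scalar multiples.\<close>

lemma vector_3_eq_sum_axis:
  "(vector [x, y, z] :: real ^ 3) = x *\<^sub>R axis 1 1 + y *\<^sub>R axis 2 1 + z *\<^sub>R axis 3 1"
  by (simp add: vec_eq_iff forall_3 axis_def)

lemma has_vector_derivative_vector_3:
  fixes f g h :: "real \<Rightarrow> real"
  assumes "(f has_real_derivative f') (at t within S)"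
    and "(g has_real_derivative g') (at t within S)"
    and "(h has_real_derivative h') (at t within S)"
  shows "((\<lambda>t. vector [f t, g t, h t] :: real ^ 3) has_vector_derivative vector [f', g', h'])
           (at t within S)"
proof -
  have scaled: "((\<lambda>t. k t *\<^sub>R v) has_vector_derivative k' *\<^sub>R v) (at t within S)"
    if "(k has_real_derivative k') (at t within S)" for k k' and v :: "real ^ 3"
    using has_vector_derivative_scaleR[OF that has_vector_derivative_const[of v]] by simp
  then show ?thesis
    unfolding vector_3_eq_sum_axis
    by (intro has_vector_derivative_add scaled assms)
qed

text \<open>Taking the third coordinate is bounded linear, so it carries the derivatives
  \<open>F n\<close> of the curve over to \<open>z\<close>; the existence of \<open>F 2\<close>
  makes \<open>z'\<close> continuous.\<close>

lemma smooth_on_profile_curveE: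
  assumes "smooth_on S (profile_curve z)"
  obtains z' where "\<And>t. t \<in> S \<Longrightarrow> (z has_real_derivative z' t) (at t within S)"
    and "continuous_on S z'"
proof -
  obtain F where F0: "F 0 = profile_curve z"
    and F: "\<And>n t. t \<in> S \<Longrightarrow> (F n has_vector_derivative F (Suc n) t) (at t within S)"
    using assms unfolding smooth_on_def by blast
  have comp: "((\<lambda>s. F n s $ 3) has_real_derivative F (Suc n) t $ 3) (at t within S)"
    if "t \<in> S" for n t
    using bounded_linear.has_vector_derivative[OF bounded_linear_vec_nth F[OF that]]
    by (simp add: has_real_derivative_iff_has_vector_derivative)
  show thesis
  proof (rule that)
    show "(z has_real_derivative F 1 t $ 3) (at t within S)" if "t \<in> S" for t
      using comp[OF that, of 0] by (simp add: F0 profile_curve_def)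
    show "continuous_on S (\<lambda>t. F 1 t $ 3)"
      using comp by (rule DERIV_continuous_on)
  qed
qed

text \<open>This admits the logarithmic profile as a competitor. On positive \<open>t\<close> all
  its derivatives have a closed form, which serves as the witness.\<close>

lemma smooth_on_profile_curve_log:
  assumes "\<And>t. t \<in> S \<Longrightarrow> 0 < t"
  shows "smooth_on S (profile_curve (\<lambda>t. c * ln t + d))"
proof -
  \<comment> \<open>The \<open>n\<close>-th derivative of \<open>c * ln t + d\<close>. Powers of
    \<open>inverse t\<close> let the power rule at \<open>Suc m\<close> produce both the factor that
    extends the factorial and the change of sign.\<close>
  define G where "G n t = (if n = 0 then c * ln t + d
    else c * (-1) ^ (n - 1) * fact (n - 1) * inverse t ^ n)" for n and t :: real
  define F where "F n t = (vector
    [if n = 0 then t else if n = 1 then 1 else 0, 0, G n t] :: real ^ 3)" for n :: nat and t :: real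
  have G: "(G n has_real_derivative G (Suc n) t) (at t within S)" if "t \<in> S" for n t
  proof (cases n)
    case 0
    show ?thesis
      using assms[OF that] unfolding 0 G_def by (auto intro!: derivative_eq_intros simp: divide_inverse)
  next
    case (Suc m)
    have "(inverse has_real_derivative - (inverse t * inverse t)) (at t within S)"
      using assms[OF that] by (auto intro!: derivative_eq_intros)
    from DERIV_cmult[OF DERIV_power_Suc[OF this], of "c * (-1) ^ m * fact m" m] show ?thesis
      unfolding Suc G_def by (simp add: algebra_simps)
  qed
  have "(F n has_vector_derivative F (Suc n) t) (at t within S)" if "t \<in> S" for n t
    unfolding F_def
    by (rule has_vector_derivative_vector_3) (auto intro!: G that derivative_eq_intros)
  moreover have "F 0 = profile_curve (\<lambda>t. c * ln t + d)"
    by (simp add: fun_eq_iff F_def G_def profile_curve_def)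
  ultimately show ?thesis
    unfolding smooth_on_def by blast
qed

text \<open>Here \<open>X_12 = t > 0\<close>, so the surface is admissible and the normal is
  \<open>(-z' cos, -z' sin, (1 - z'^2) / 2)\<close>. The determinant is then
  \<open>t * (z'^2 + (1 - z'^2) / 2)\<close>.\<close>

lemma relative_area_density_revolution:
  assumes z': "(z has_real_derivative z') (at t within {a..b})"
    and "a < b" "t \<in> {a..b}" "0 < t" "\<theta> \<in> {0..2 * pi}"
  shows "relative_area_density {a..b} {0..2 * pi} (revolution z) t \<theta> = t * (1 + z'\<^sup>2) / 2"
proof -
  \<comment> \<open>On a closed interval of positive length the relative derivative is unique even
    at the endpoints, so exhibiting one determines the partial derivative.\<close>
  have p: "partial1 {a..b} (revolution z) t \<theta> = vector [cos \<theta>, sin \<theta>, z']"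
    unfolding partial1_def revolution_def using assms
    by (intro vector_derivative_within_closed_interval has_vector_derivative_vector_3)
       (auto intro!: derivative_eq_intros)
  have q: "partial2 {0..2 * pi} (revolution z) t \<theta> = vector [- t * sin \<theta>, t * cos \<theta>, 0]"
    unfolding partial2_def revolution_def using assms
    by (intro vector_derivative_within_closed_interval has_vector_derivative_vector_3)
       (auto intro!: derivative_eq_intros)
  have X12: "minor (vector [cos \<theta>, sin \<theta>, z']) (vector [- t * sin \<theta>, t * cos \<theta>, 0]) 1 2 = t"
  proof -
    have "minor (vector [cos \<theta>, sin \<theta>, z']) (vector [- t * sin \<theta>, t * cos \<theta>, 0]) 1 2
        = t * ((cos \<theta>)\<^sup>2 + (sin \<theta>)\<^sup>2)"
      unfolding minor_def vector_3 by algebra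
    then show ?thesis by simp
  qed
  have X23: "minor (vector [cos \<theta>, sin \<theta>, z']) (vector [- t * sin \<theta>, t * cos \<theta>, 0]) 2 3
      = - (z' * t * cos \<theta>)"
    by (simp add: minor_def)
  have X31: "minor (vector [cos \<theta>, sin \<theta>, z']) (vector [- t * sin \<theta>, t * cos \<theta>, 0]) 3 1
      = - (z' * t * sin \<theta>)"
    by (simp add: minor_def)
  have "(z' * t * cos \<theta>)\<^sup>2 + (z' * t * sin \<theta>)\<^sup>2 = z'\<^sup>2 * t\<^sup>2"
    by (simp add: sin_squared_eq power_mult_distrib algebra_simps)
  then have N: "parabolic_normal (vector [cos \<theta>, sin \<theta>, z']) (vector [- t * sin \<theta>, t * cos \<theta>, 0])
      = vector [- z' * cos \<theta>, - z' * sin \<theta>, (1 - z'\<^sup>2) / 2]"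
    unfolding parabolic_normal_def X12 X23 X31
    using \<open>0 < t\<close> by (simp add: diff_divide_distrib)
  \<comment> \<open>Naming the third coordinate of the normal keeps the determinant expansion
    polynomial.\<close>
  define k where "k = (1 - z'\<^sup>2) / 2"
  have "relative_area_density {a..b} {0..2 * pi} (revolution z) t \<theta>
      = t * (((cos \<theta>)\<^sup>2 + (sin \<theta>)\<^sup>2) * (z'\<^sup>2 + k))"
    unfolding relative_area_density_def p q Let_def N det_3 vector_3 k_def[symmetric]
    by (simp only: power2_eq_square algebra_simps mult_zero_left mult_zero_right
        mult_minus_left mult_minus_right add_0_left add_0_right diff_0_right minus_minus)
  then show ?thesis
    by (simp add: k_def field_simps)
qed

text \<open>The density does not depend on the angle, so the inner integral contributes a factor
  \<open>2 * pi\<close>, which meets the \<open>1 / 2\<close> of the density.\<close>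

lemma revolution_relative_area_eq:
  assumes z': "\<And>t. t \<in> {a..b} \<Longrightarrow> (z has_real_derivative z' t) (at t within {a..b})"
    and "0 < a" "a < b"
  shows "revolution_relative_area a b z = pi * integral {a..b} (\<lambda>t. t * (1 + (z' t)\<^sup>2))"
proof -
  have inner: "integral {0..2 * pi} (relative_area_density {a..b} {0..2 * pi} (revolution z) t)
      = pi * (t * (1 + (z' t)\<^sup>2))" if "t \<in> {a..b}" for t
  proof -
    have "integral {0..2 * pi} (relative_area_density {a..b} {0..2 * pi} (revolution z) t)
        = integral {0..2 * pi} (\<lambda>_. t * (1 + (z' t)\<^sup>2) / 2)"
      using assms that by (intro integral_cong relative_area_density_revolution) auto
    then show ?thesis by simp
  qed
  have "revolution_relative_area a b z = integral {a..b} (\<lambda>t. pi * (t * (1 + (z' t)\<^sup>2)))"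
    unfolding revolution_relative_area_def relative_area_def by (rule integral_cong) (rule inner)
  then show ?thesis by simp
qed

text \<open>The offset of a logarithmic profile does not affect its slope \<open>c / t\<close>, so
  equality of boundary values enters only through the increment of \<open>z\<close>.\<close>

lemma integral_compare_log:
  fixes z z' :: "real \<Rightarrow> real"
  assumes z': "\<And>t. t \<in> {a..b} \<Longrightarrow> (z has_real_derivative z' t) (at t within {a..b})"
    and cont: "continuous_on {a..b} z'"
    and "0 < a" "a < b"
    and "z b - z a = c * (ln b - ln a)"
  shows "integral {a..b} (\<lambda>t. t * (1 + (z' t)\<^sup>2))
       = integral {a..b} (\<lambda>t. t * (1 + (c / t)\<^sup>2)) + integral {a..b} (\<lambda>t. t * (z' t - c / t)\<^sup>2)"
proof -
  \<comment> \<open>The mixed term of the square has the antiderivative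
    \<open>2 * c * (z t - c * ln t)\<close>, which takes equal values at \<open>a\<close> and
    \<open>b\<close>.\<close>
  have "((\<lambda>t. 2 * c * (z' t - c / t)) has_integral
      2 * c * (z b - c * ln b) - 2 * c * (z a - c * ln a)) {a..b}"
  proof (rule fundamental_theorem_of_calculus)
    fix t assume t: "t \<in> {a..b}"
    then have "0 < t" using \<open>0 < a\<close> by simp
    then show "((\<lambda>t. 2 * c * (z t - c * ln t)) has_vector_derivative 2 * c * (z' t - c / t))
        (at t within {a..b})"
      unfolding has_real_derivative_iff_has_vector_derivative[symmetric]
      by (auto intro!: derivative_eq_intros z' t)
  qed (use \<open>a < b\<close> in simp)
  moreover have "2 * c * (z b - c * ln b) - 2 * c * (z a - c * ln a) = 0"
    using assms(5) by algebra
  ultimately have cross: "((\<lambda>t. 2 * c * (z' t - c / t)) has_integral 0) {a..b}"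
    by simp
  have "(\<lambda>t. t * (1 + (c / t)\<^sup>2)) integrable_on {a..b}"
    and "(\<lambda>t. t * (z' t - c / t)\<^sup>2) integrable_on {a..b}"
    using \<open>0 < a\<close> by (auto intro!: integrable_continuous_interval continuous_intros cont)
  then have "((\<lambda>t. t * (1 + (c / t)\<^sup>2) + t * (z' t - c / t)\<^sup>2 + 2 * c * (z' t - c / t)) has_integral
      integral {a..b} (\<lambda>t. t * (1 + (c / t)\<^sup>2)) + integral {a..b} (\<lambda>t. t * (z' t - c / t)\<^sup>2) + 0)
      {a..b}"
    by (intro has_integral_add cross integrable_integral)
  moreover have "t * (1 + (c / t)\<^sup>2) + t * (z' t - c / t)\<^sup>2 + 2 * c * (z' t - c / t)
      = t * (1 + (z' t)\<^sup>2)" if "t \<in> {a..b}" for t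
    using that \<open>0 < a\<close> by (simp add: field_simps power2_eq_square)
  ultimately have "((\<lambda>t. t * (1 + (z' t)\<^sup>2)) has_integral
      integral {a..b} (\<lambda>t. t * (1 + (c / t)\<^sup>2)) + integral {a..b} (\<lambda>t. t * (z' t - c / t)\<^sup>2) + 0)
      {a..b}"
    by (rule has_integral_eq[rotated])
  then show ?thesis
    by (simp add: integral_unique)
qed

text \<open>The slopes \<open>c / t\<close> solve the Euler-Lagrange equation
  \<open>(t z')' = 0\<close> of the integrand \<open>t (1 + z'^2)\<close>. Comparing
  \<open>z\<close> with the solution through its endpoints replaces a variational argument.\<close>

lemma minimum_relative_area_imp_log:
  assumes "0 < a" "a < b" and min: "minimum_relative_area a b z"
  obtains c d where "\<And>t. t \<in> {a..b} \<Longrightarrow> z t = c * ln t + d"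
proof -
  \<comment> \<open>\<open>c\<close> matches the increment of \<open>z\<close> over the interval,
    and the offset in \<open>w\<close> then matches the value at \<open>a\<close>.\<close>
  define c where "c = (z b - z a) / (ln b - ln a)"
  define w where "w t = c * ln t + (z a - c * ln a)" for t
  have "ln a < ln b" using assms by simp
  then have c: "z b - z a = c * (ln b - ln a)"
    by (simp add: c_def)
  have pos: "0 < t" if "t \<in> {a..b}" for t
    using that \<open>0 < a\<close> by simp
  obtain z' where z': "\<And>t. t \<in> {a..b} \<Longrightarrow> (z has_real_derivative z' t) (at t within {a..b})"
    and cont: "continuous_on {a..b} z'"
    using min smooth_on_profile_curveE unfolding minimum_relative_area_def by blast
  have w': "(w has_real_derivative c / t) (at t within {a..b})" if "t \<in> {a..b}" for t
    unfolding w_def using pos[OF that] by (auto intro!: derivative_eq_intros)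
  have area_z: "revolution_relative_area a b z = pi * integral {a..b} (\<lambda>t. t * (1 + (z' t)\<^sup>2))"
    using z' assms(1,2) by (rule revolution_relative_area_eq)
  have area_w: "revolution_relative_area a b w = pi * integral {a..b} (\<lambda>t. t * (1 + (c / t)\<^sup>2))"
    using w' assms(1,2) by (rule revolution_relative_area_eq)
  have cont_sq: "continuous_on {a..b} (\<lambda>t. t * (z' t - c / t)\<^sup>2)"
    using \<open>0 < a\<close> by (auto intro!: continuous_intros cont)
  have nonneg: "0 \<le> t * (z' t - c / t)\<^sup>2" if "t \<in> {a..b}" for t
    using pos[OF that] by simp
  have "smooth_on {a..b} (profile_curve w)"
    unfolding w_def using pos by (rule smooth_on_profile_curve_log)
  moreover have "w a = z a" "w b = z b"
    using c by (simp_all add: w_def algebra_simps)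
  ultimately have "revolution_relative_area a b z \<le> revolution_relative_area a b w"
    using min unfolding minimum_relative_area_def by blast
  then have "integral {a..b} (\<lambda>t. t * (1 + (z' t)\<^sup>2)) \<le> integral {a..b} (\<lambda>t. t * (1 + (c / t)\<^sup>2))"
    unfolding area_z area_w by simp
  then have "integral {a..b} (\<lambda>t. t * (z' t - c / t)\<^sup>2) \<le> 0"
    using integral_compare_log[OF z' cont assms(1,2) c] by simp
  moreover have "0 \<le> integral {a..b} (\<lambda>t. t * (z' t - c / t)\<^sup>2)"
    using nonneg by (intro integral_nonneg integrable_continuous_interval cont_sq)
  ultimately have "integral {a..b} (\<lambda>t. t * (z' t - c / t)\<^sup>2) = 0"
    by simp
  \<comment> \<open>A continuous nonnegative function with zero integral vanishes at every point; as
    \<open>t > 0\<close>, the square itself vanishes.\<close>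
  then have "\<forall>t\<in>{a..b}. t * (z' t - c / t)\<^sup>2 = 0"
    using integral_eq_0_iff[OF cont_sq \<open>a < b\<close> nonneg] by simp
  then have z'_eq: "z' t = c / t" if "t \<in> {a..b}" for t
    using that pos by fastforce
  \<comment> \<open>Equal derivatives on an interval leave only a constant difference, which is
    absorbed into \<open>d\<close>.\<close>
  obtain k where k: "\<And>t. t \<in> {a..b} \<Longrightarrow> z t - w t = k"
  proof (rule has_vector_derivative_zero_constant)
    show "((\<lambda>t. z t - w t) has_vector_derivative 0) (at t within {a..b})" if "t \<in> {a..b}" for t
      using DERIV_diff[OF z'[OF that] w'[OF that]]
      by (simp add: z'_eq[OF that] has_real_derivative_iff_has_vector_derivative)
  qed auto
  show thesis
    by (rule that[of c "k + (z a - c * ln a)"]) (use k in \<open>simp add: w_def algebra_simps\<close>)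
qed

theorem theorem5:
  fixes a b :: real and z :: "real \<Rightarrow> real"
  assumes "0 < a" and "a < b"
    and "smooth_on {a..b} (profile_curve z)"
    and "minimum_relative_area a b z"
  shows "(\<exists>h. (\<forall>t\<in>{a..b}. profile_curve z t = vector [t, 0, h]) \<and>
              revolution_surface a b z \<subseteq> horizontal_plane h) \<or>
         (\<exists>c d. c \<noteq> 0 \<and> (\<forall>t\<in>{a..b}. z t = c * ln t + d))"
proof -
  obtain c d where z: "\<And>t. t \<in> {a..b} \<Longrightarrow> z t = c * ln t + d"
    using minimum_relative_area_imp_log[OF assms(1,2,4)] by blast
  show ?thesis
  \<comment> \<open>For \<open>c = 0\<close> the profile is constant, and \<open>d\<close> is the
    height of the plane; otherwise it is the catenary.\<close>
  proof (cases "c = 0")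
    case True
    then have "\<forall>t\<in>{a..b}. profile_curve z t = vector [t, 0, d]"
      and "revolution_surface a b z \<subseteq> horizontal_plane d"
      using z by (auto simp: profile_curve_def revolution_surface_def revolution_def
          horizontal_plane_def)
    then show ?thesis by blast
  next
    case False
    then show ?thesis using z by blast
  qed
qed

end
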